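(* Let $F=\alpha\phi(s)$, $s=\beta/\alpha$, be an $(\alpha,\beta)$-metric on a smooth manifold $M$. Then its $T$-tensor has the form $$\begin{aligned}T_{hijk}={}&\Phi\,(h_{hi}h_{jk}+h_{hj}h_{ik}+h_{hk}h_{ij})\\&+\Psi\,(h_{hk}m_im_j+h_{hj}m_im_k+h_{hi}m_jm_k+h_{ij}m_hm_k+h_{jk}m_im_h+h_{ik}m_jm_h)\\&+\Omega\,m_hm_im_jm_k,\end{aligned}$$ where $$\Phi:=-\frac{\rho_1\phi}{2\alpha}(s+\alpha K_1m^2),\qquad \Psi:=\frac{\rho_1\phi'}{\alpha}-\frac{\rho_1^2\phi}{\alpha\rho}-\frac{s\rho_0'\phi}{2\alpha}-\frac{\rho_1\phi m^2K_2}{2},$$ $$\Omega:=\frac{\rho_0''\phi}{2\alpha}+\frac{2\rho_0'\phi'}{\alpha}-3\phi\left(K_2\Big(\rho_1+\frac{\rho_0'm^2}{2}\Big)+\frac{\rho_1\rho_0'}{2\alpha\rho}\right),$$ $$K_1:=\frac{\rho_1(1+\rho\mu_0m^2)}{2\alpha\rho}=\frac{\rho_1}{2\alpha(\rho+m^2\phi\phi'')},$$ $$K_2:=\frac{\rho_0'(1+\rho\mu_0m^2)}{2\alpha\rho}+\frac{\rho_1\mu_0}{\alpha}=\frac{\rho\rho_0'-2\rho_1\phi\phi''}{2\alpha\rho(\rho+m^2\phi\phi'')}.$$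
   Context: $(\alpha,\beta)$-metrics. $M$ is an $n$-dimensional smooth manifold with induced local coordinates $(x^i,y^i)$ on $TM$; $\alpha=\sqrt{a_{ij}(x)y^iy^j}$ is the norm of a Riemannian metric, $\beta=b_i(x)y^i$ a 1-form. $(a^{ij})$ is the inverse of $(a_{ij})$, $b^i:=a^{ij}b_j$, $b^2:=b^ib_i$ (a function of $x$). Let $b_0>0$, let $J=(-b_0,b_0)$ or $J=(0,b_0)$, let $\phi:J\to\mathbb R$ be smooth, and assume $b(x)\le b_0$ for all $x$. $F:=\alpha\,\phi(s)$ with $s:=\beta/\alpha$, defined on the open set $\mathcal D$ of nonzero tangent vectors with $s\in J$; all identities are on $\mathcal D$. It is assumed that $\phi(t)>0$ and $\phi(t)-t\phi'(t)+(x^2-t^2)\phi''(t)>0$ for $t\in J$, $|t|<x<b_0$, and that $g_{ij}:=\frac12\frac{\partial^2F^2}{\partial y^i\partial y^j}$ is nondegenerate on $\mathcal D$, i.e. $\phi-s\phi'\ne0$ and $\phi-s\phi'+(b^2-s^2)\phi''\neq 0$ there. Primes denote derivatives in $s$. Put $\alpha_i:=\partial\alpha/\partial y^i$, $h_{ij}:=a_{ij}-\alpha_i\alpha_j$, $m_i:=b_i-s\alpha_i$, $m^2:=b^2-s^2$, $$\rho:=\phi^2-s\phi\phi',\quad \rho_0:=\phi'^2+\phi\phi'',\quad \rho_1:=\phi\phi'-s(\phi'^2+\phi\phi''),\quad \mu_0:=-\frac{\phi\phi''}{\rho(\rho+\phi\phi''m^2)}.$$ $T$-tensor: with $\dot\partial_i=\partial/\partial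 y^i$, $C_{ijk}=\frac12\dot\partial_kg_{ij}$, $C^s_{ij}=g^{sr}C_{rij}$, $C_{rijk}=\dot\partial_rC_{ijk}$, $\ell_i=\dot\partial_iF$, $$T_{rijk}=FC_{rijk}-F(C_{sij}C^s_{rk}+C_{sjr}C^s_{ik}+C_{sir}C^s_{jk})+C_{rij}\ell_k+C_{rik}\ell_j+C_{rjk}\ell_i+C_{ijk}\ell_r .$$ *)

theory Defs
  imports "HOL-Analysis.Analysis"
begin

section \<open>Smooth manifolds and tensor fields in local coordinates\<close>

text \<open>\<open>Ck_on k S f\<close>: \<open>f\<close> is \<open>k\<close> times continuously differentiable on the open set \<open>S\<close>.\<close>

primrec Ck_on :: "nat \<Rightarrow> 'a::euclidean_space set \<Rightarrow> ('a \<Rightarrow> 'b::real_normed_vector) \<Rightarrow> bool" where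
  "Ck_on 0 S f \<longleftrightarrow> continuous_on S f"
| "Ck_on (Suc k) S f \<longleftrightarrow>
     (\<forall>x\<in>S. f differentiable (at x)) \<and>
     (\<forall>v. Ck_on k S (\<lambda>x. frechet_derivative f (at x) v))"

definition smooth_on :: "'a::euclidean_space set \<Rightarrow> ('a \<Rightarrow> 'b::real_normed_vector) \<Rightarrow> bool" where
  "smooth_on S f \<longleftrightarrow> (\<forall>k. Ck_on k S f)"

text \<open>A chart is a pair of a domain and a coordinate map \<open>p \<mapsto> (x\<^sup>1, \<dots>, x\<^sup>n)\<close>, of which only the values
  on the domain matter. The dimension is \<open>n = CARD('n)\<close>.\<close>

type_synonym ('m, 'n) chart = "'m set \<times> ('m \<Rightarrow> real ^ 'n)"

definition chart_inv :: "('m, 'n::finite) chart \<Rightarrow> real ^ 'n \<Rightarrow> 'm" where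
  "chart_inv c = inv_into (fst c) (snd c)"

definition is_chart :: "'m topology \<Rightarrow> ('m, 'n::finite) chart \<Rightarrow> bool" where
  "is_chart M c \<longleftrightarrow>
     openin M (fst c) \<and> open (snd c ` fst c) \<and>
     homeomorphic_map (subtopology M (fst c)) (top_of_set (snd c ` fst c)) (snd c)"

definition transition :: "('m, 'n::finite) chart \<Rightarrow> ('m, 'n) chart \<Rightarrow> real ^ 'n \<Rightarrow> real ^ 'n" where
  "transition c d = snd d \<circ> chart_inv c"

definition smooth_manifold :: "'m topology \<Rightarrow> ('m, 'n::finite) chart set \<Rightarrow> bool" where
  "smooth_manifold M \<A> \<longleftrightarrow>
     Hausdorff_space M \<and> second_countable M \<and>
     (\<forall>c\<in>\<A>. is_chart M c) \<and> (\<Union>c\<in>\<A>. fst c) = topspace M \<and>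
     (\<forall>c\<in>\<A>. \<forall>d\<in>\<A>. smooth_on (snd c ` (fst c \<inter> fst d)) (transition c d))"

text \<open>\<open>jacobian c d p $ i $ j\<close> is the derivative of the \<open>i\<close>-th coordinate of \<open>d\<close> with respect to the
  \<open>j\<close>-th coordinate of \<open>c\<close> at \<open>p\<close>.\<close>

definition jacobian :: "('m, 'n::finite) chart \<Rightarrow> ('m, 'n) chart \<Rightarrow> 'm \<Rightarrow> real ^ 'n ^ 'n" where
  "jacobian c d p = matrix (frechet_derivative (transition c d) (at (snd c p)))"

text \<open>Covariant tensor fields are given by their components in every chart of the atlas, subject to
  the transformation law: \<open>a c p $ i $ j\<close> is the component with lower indices \<open>i\<close>, \<open>j\<close> at the point
  \<open>p\<close> in the chart \<open>c\<close>.\<close>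

definition riemannian_metric ::
  "('m, 'n::finite) chart set \<Rightarrow> (('m, 'n) chart \<Rightarrow> 'm \<Rightarrow> real ^ 'n ^ 'n) \<Rightarrow> bool" where
  "riemannian_metric \<A> a \<longleftrightarrow>
     (\<forall>c\<in>\<A>. smooth_on (snd c ` fst c) (a c \<circ> chart_inv c) \<and>
        (\<forall>p\<in>fst c. transpose (a c p) = a c p \<and> (\<forall>v. v \<noteq> 0 \<longrightarrow> v \<bullet> (a c p *v v) > 0))) \<and>
     (\<forall>c\<in>\<A>. \<forall>d\<in>\<A>. \<forall>p\<in>fst c \<inter> fst d.
        a c p = transpose (jacobian c d p) ** a d p ** jacobian c d p)"

definition one_form ::
  "('m, 'n::finite) chart set \<Rightarrow> (('m, 'n) chart \<Rightarrow> 'm \<Rightarrow> real ^ 'n) \<Rightarrow> bool" where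
  "one_form \<A> b \<longleftrightarrow>
     (\<forall>c\<in>\<A>. smooth_on (snd c ` fst c) (b c \<circ> chart_inv c)) \<and>
     (\<forall>c\<in>\<A>. \<forall>d\<in>\<A>. \<forall>p\<in>fst c \<inter> fst d. b c p = transpose (jacobian c d p) *v b d p)"


section \<open>The T-tensor of a function on a tangent space\<close>

text \<open>Below, a function \<open>F\<close> on the tangent space at a fixed point is written in the induced
  coordinates \<open>y\<close>; \<open>pd i\<close> is the partial derivative with respect to \<open>y\<^sup>i\<close>.\<close>

definition pd :: "'n::finite \<Rightarrow> (real ^ 'n \<Rightarrow> real) \<Rightarrow> real ^ 'n \<Rightarrow> real" where
  "pd i f y = deriv (\<lambda>t. f (y + t *\<^sub>R axis i 1)) 0"

definition fund_tensor :: "(real ^ 'n::finite \<Rightarrow> real) \<Rightarrow> 'n \<Rightarrow> 'n \<Rightarrow> real ^ 'n \<Rightarrow> real" where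
  "fund_tensor F i j y = 1/2 * pd i (pd j (\<lambda>z. (F z)\<^sup>2)) y"

definition fund_matrix :: "(real ^ 'n::finite \<Rightarrow> real) \<Rightarrow> real ^ 'n \<Rightarrow> real ^ 'n ^ 'n" where
  "fund_matrix F y = (\<chi> i j. fund_tensor F i j y)"

definition cartan :: "(real ^ 'n::finite \<Rightarrow> real) \<Rightarrow> 'n \<Rightarrow> 'n \<Rightarrow> 'n \<Rightarrow> real ^ 'n \<Rightarrow> real" where
  "cartan F i j k y = 1/2 * pd k (fund_tensor F i j) y"

text \<open>\<open>cartan_up F s i j\<close> has the upper index \<open>s\<close> and the lower indices \<open>i\<close>, \<open>j\<close>.\<close>

definition cartan_up :: "(real ^ 'n::finite \<Rightarrow> real) \<Rightarrow> 'n \<Rightarrow> 'n \<Rightarrow> 'n \<Rightarrow> real ^ 'n \<Rightarrow> real" where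
  "cartan_up F s i j y = (\<Sum>r\<in>UNIV. matrix_inv (fund_matrix F y) $ s $ r * cartan F r i j y)"

definition T_tensor ::
  "(real ^ 'n::finite \<Rightarrow> real) \<Rightarrow> 'n \<Rightarrow> 'n \<Rightarrow> 'n \<Rightarrow> 'n \<Rightarrow> real ^ 'n \<Rightarrow> real" where
  "T_tensor F r i j k y =
     F y * pd r (cartan F i j k) y
     - F y * (\<Sum>s\<in>UNIV. cartan F s i j y * cartan_up F s r k y
                       + cartan F s j r y * cartan_up F s i k y
                       + cartan F s i r y * cartan_up F s j k y)
     + cartan F r i j y * pd k F y + cartan F r i k y * pd j F y
     + cartan F r j k y * pd i F y + cartan F i j k y * pd r F y"


section \<open>\<open>(\<alpha>, \<beta>)\<close>-metrics\<close>

text \<open>\<open>A\<close> and \<open>B\<close> stand for the components of the Riemannian metric and of the 1-form at a fixed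
  point in a fixed chart.\<close>

definition alpha :: "real ^ 'n ^ 'n \<Rightarrow> real ^ 'n::finite \<Rightarrow> real" where
  "alpha A y = sqrt (\<Sum>i\<in>UNIV. \<Sum>j\<in>UNIV. A $ i $ j * y $ i * y $ j)"

definition beta :: "real ^ 'n \<Rightarrow> real ^ 'n::finite \<Rightarrow> real" where
  "beta B y = (\<Sum>i\<in>UNIV. B $ i * y $ i)"

definition s_var :: "real ^ 'n ^ 'n \<Rightarrow> real ^ 'n \<Rightarrow> real ^ 'n::finite \<Rightarrow> real" where
  "s_var A B y = beta B y / alpha A y"

definition ab_metric ::
  "(real \<Rightarrow> real) \<Rightarrow> real ^ 'n ^ 'n \<Rightarrow> real ^ 'n \<Rightarrow> real ^ 'n::finite \<Rightarrow> real" where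
  "ab_metric \<phi> A B y = alpha A y * \<phi> (s_var A B y)"

definition ab_domain ::
  "real set \<Rightarrow> real ^ 'n ^ 'n \<Rightarrow> real ^ 'n \<Rightarrow> (real ^ 'n::finite) set" where
  "ab_domain J A B = {y. y \<noteq> 0 \<and> s_var A B y \<in> J}"

definition b_up :: "real ^ 'n ^ 'n \<Rightarrow> real ^ 'n \<Rightarrow> 'n::finite \<Rightarrow> real" where
  "b_up A B i = (\<Sum>j\<in>UNIV. matrix_inv A $ i $ j * B $ j)"

definition b_sq :: "real ^ 'n ^ 'n \<Rightarrow> real ^ 'n::finite \<Rightarrow> real" where
  "b_sq A B = (\<Sum>i\<in>UNIV. b_up A B i * B $ i)"

definition h_low :: "real ^ 'n ^ 'n \<Rightarrow> 'n::finite \<Rightarrow> 'n \<Rightarrow> real ^ 'n \<Rightarrow> real" where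
  "h_low A i j y = A $ i $ j - pd i (alpha A) y * pd j (alpha A) y"

definition m_low :: "real ^ 'n ^ 'n \<Rightarrow> real ^ 'n \<Rightarrow> 'n::finite \<Rightarrow> real ^ 'n \<Rightarrow> real" where
  "m_low A B i y = B $ i - s_var A B y * pd i (alpha A) y"

definition m_sq :: "real ^ 'n ^ 'n \<Rightarrow> real ^ 'n \<Rightarrow> real ^ 'n::finite \<Rightarrow> real" where
  "m_sq A B y = b_sq A B - (s_var A B y)\<^sup>2"

definition rho :: "(real \<Rightarrow> real) \<Rightarrow> real \<Rightarrow> real" where
  "rho \<phi> s = (\<phi> s)\<^sup>2 - s * \<phi> s * deriv \<phi> s"

definition rho0 :: "(real \<Rightarrow> real) \<Rightarrow> real \<Rightarrow> real" where
  "rho0 \<phi> s = (deriv \<phi> s)\<^sup>2 + \<phi> s * deriv (deriv \<phi>) s"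

definition rho1 :: "(real \<Rightarrow> real) \<Rightarrow> real \<Rightarrow> real" where
  "rho1 \<phi> s = \<phi> s * deriv \<phi> s - s * ((deriv \<phi> s)\<^sup>2 + \<phi> s * deriv (deriv \<phi>) s)"

text \<open>In the following, \<open>m2\<close> stands for the value of \<open>m\<^sup>2 = b\<^sup>2 - s\<^sup>2\<close> and \<open>al\<close> for that of \<open>\<alpha>\<close>.\<close>

definition mu0 :: "(real \<Rightarrow> real) \<Rightarrow> real \<Rightarrow> real \<Rightarrow> real" where
  "mu0 \<phi> s m2 =
     - (\<phi> s * deriv (deriv \<phi>) s) / (rho \<phi> s * (rho \<phi> s + \<phi> s * deriv (deriv \<phi>) s * m2))"

definition K1 :: "(real \<Rightarrow> real) \<Rightarrow> real \<Rightarrow> real \<Rightarrow> real \<Rightarrow> real" where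
  "K1 \<phi> al s m2 = rho1 \<phi> s * (1 + rho \<phi> s * mu0 \<phi> s m2 * m2) / (2 * al * rho \<phi> s)"

definition K2 :: "(real \<Rightarrow> real) \<Rightarrow> real \<Rightarrow> real \<Rightarrow> real \<Rightarrow> real" where
  "K2 \<phi> al s m2 =
     deriv (rho0 \<phi>) s * (1 + rho \<phi> s * mu0 \<phi> s m2 * m2) / (2 * al * rho \<phi> s)
     + rho1 \<phi> s * mu0 \<phi> s m2 / al"

definition Phi_coeff :: "(real \<Rightarrow> real) \<Rightarrow> real \<Rightarrow> real \<Rightarrow> real \<Rightarrow> real" where
  "Phi_coeff \<phi> al s m2 = - (rho1 \<phi> s * \<phi> s / (2 * al)) * (s + al * K1 \<phi> al s m2 * m2)"

definition Psi_coeff :: "(real \<Rightarrow> real) \<Rightarrow> real \<Rightarrow> real \<Rightarrow> real \<Rightarrow> real" where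
  "Psi_coeff \<phi> al s m2 =
     rho1 \<phi> s * deriv \<phi> s / al
     - (rho1 \<phi> s)\<^sup>2 * \<phi> s / (al * rho \<phi> s)
     - s * deriv (rho0 \<phi>) s * \<phi> s / (2 * al)
     - rho1 \<phi> s * \<phi> s * m2 * K2 \<phi> al s m2 / 2"

definition Omega_coeff :: "(real \<Rightarrow> real) \<Rightarrow> real \<Rightarrow> real \<Rightarrow> real \<Rightarrow> real" where
  "Omega_coeff \<phi> al s m2 =
     deriv (deriv (rho0 \<phi>)) s * \<phi> s / (2 * al)
     + 2 * deriv (rho0 \<phi>) s * deriv \<phi> s / al
     - 3 * \<phi> s * (K2 \<phi> al s m2 * (rho1 \<phi> s + deriv (rho0 \<phi>) s * m2 / 2)
                 + rho1 \<phi> s * deriv (rho0 \<phi>) s / (2 * al * rho \<phi> s))"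

text \<open>The standing assumptions relating \<open>\<phi>\<close>, \<open>J\<close> and \<open>b\<^sub>0\<close>; here \<open>x\<close> is a real number, not a
  point of the manifold.\<close>

definition admissible_phi :: "real \<Rightarrow> real set \<Rightarrow> (real \<Rightarrow> real) \<Rightarrow> bool" where
  "admissible_phi b0 J \<phi> \<longleftrightarrow>
     b0 > 0 \<and> (J = {-b0<..<b0} \<or> J = {0<..<b0}) \<and> smooth_on J \<phi> \<and>
     (\<forall>t\<in>J. \<forall>x. \<bar>t\<bar> < x \<and> x < b0 \<longrightarrow>
        \<phi> t > 0 \<and> \<phi> t - t * deriv \<phi> t + (x\<^sup>2 - t\<^sup>2) * deriv (deriv \<phi>) t > 0)"

text \<open>Nondegeneracy of the fundamental tensor. In dimensions 1 and 2 invertibility of the matrix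
  alone does not give \<open>\<phi> - s \<phi>' \<noteq> 0\<close>, so the two scalar conditions are listed as well.\<close>

definition nondegenerate_at ::
  "(real \<Rightarrow> real) \<Rightarrow> real ^ 'n ^ 'n \<Rightarrow> real ^ 'n \<Rightarrow> real ^ 'n::finite \<Rightarrow> bool" where
  "nondegenerate_at \<phi> A B y \<longleftrightarrow>
     invertible (fund_matrix (ab_metric \<phi> A B) y) \<and>
     (let s = s_var A B y in
        \<phi> s - s * deriv \<phi> s \<noteq> 0 \<and>
        \<phi> s - s * deriv \<phi> s + (b_sq A B - s\<^sup>2) * deriv (deriv \<phi>) s \<noteq> 0)"

end

theory Submission imports Defs begin

text \<open>
  In terms of \<open>\<alpha>\<^sub>i\<close>, \<open>m\<^sub>i\<close> and \<open>h\<^sub>i\<^sub>j\<close>, which are differentiated by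
  \<open>\<partial>\<^sub>j s = m\<^sub>j / \<alpha>\<close>, \<open>\<partial>\<^sub>j \<alpha>\<^sub>i = h\<^sub>i\<^sub>j / \<alpha>\<close> and the Leibniz rule, the Cartan tensor is
  \<open>2 \<alpha> C\<^sub>i\<^sub>j\<^sub>k = \<rho>\<^sub>1 (h\<^sub>i\<^sub>j m\<^sub>k + h\<^sub>i\<^sub>k m\<^sub>j + h\<^sub>j\<^sub>k m\<^sub>i) + \<rho>\<^sub>0' m\<^sub>i m\<^sub>j m\<^sub>k\<close>, because
  \<open>\<rho>' = \<rho>\<^sub>1\<close> and \<open>\<rho>\<^sub>1' = - s \<rho>\<^sub>0'\<close>. A covector \<open>w\<close> annihilating \<open>y\<close> is raised with \<open>g\<close> by
  \<open>w \<mapsto> W / \<rho> + \<mu>\<^sub>0 (m, W) M + c y\<close>, where \<open>W\<close> and \<open>M\<close> are \<open>w\<close> and \<open>m\<close> raised with \<open>a\<close>. Since the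
  Cartan tensor annihilates \<open>y\<close>, the last term does not contribute to the products \<open>C\<^sub>s\<^sub>i\<^sub>j C\<^sup>s\<^sub>h\<^sub>k\<close>.
\<close>

section \<open>Iterated derivatives on open sets\<close>

text \<open>On an open set the derivative at a point depends only on nearby values. Induction passes
  from the functions to their directional derivatives, hence the generalisation over both
  functions.\<close>

lemma Ck_on_cong:
  assumes "open S" "\<And>x. x \<in> S \<Longrightarrow> f x = g x" "Ck_on k S f"
  shows "Ck_on k S g"
  using assms(2,3)
proof (induction k arbitrary: f g)
  case 0
  then show ?case by (simp cong: continuous_on_cong)
next
  case (Suc k)
  have D: "(f has_derivative D) (at x) \<longleftrightarrow> (g has_derivative D) (at x)" if "x \<in> S" for x D
    using has_derivative_transform_within_open[of f D x UNIV S g]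
      has_derivative_transform_within_open[of g D x UNIV S f] \<open>open S\<close> that Suc.prems(1) by auto
  then have "frechet_derivative f (at x) = frechet_derivative g (at x)" if "x \<in> S" for x
    using that by (simp add: frechet_derivative_def)
  then have "Ck_on k S (\<lambda>x. frechet_derivative g (at x) v)" for v
    using Suc.IH[of "\<lambda>x. frechet_derivative f (at x) v" "\<lambda>x. frechet_derivative g (at x) v"] Suc.prems(2)
    by simp
  then show ?case
    using Suc.prems(2) D by (simp add: differentiable_def)
qed

text \<open>In one variable the directional derivative along 1 is \<open>deriv f\<close>. The two
  are shown equal on \<open>S\<close>, and \<open>Ck_on_cong\<close> transfers the
  regularity.\<close>

lemma Ck_on_Suc_real:
  fixes f :: "real \<Rightarrow> real"
  assumes "open S" "Ck_on (Suc k) S f"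
  shows "\<And>x. x \<in> S \<Longrightarrow> (f has_real_derivative deriv f x) (at x)" and "Ck_on k S (deriv f)"
proof -
  show D: "(f has_real_derivative deriv f x) (at x)" if "x \<in> S" for x
    using assms(2) that
    by (simp add: DERIV_deriv_iff_real_differentiable)
  have "frechet_derivative f (at x) 1 = deriv f x" if "x \<in> S" for x
    using fun_cong[OF frechet_derivative_at[OF D[OF that, unfolded has_field_derivative_def]], of 1]
    by (simp only: mult_1_right)
  then show "Ck_on k S (deriv f)"
    using assms Ck_on_cong[of S "\<lambda>x. frechet_derivative f (at x) 1" "deriv f" k] by simp
qed

section \<open>Rules for partial derivatives in the fibre coordinates\<close>

text \<open>Unlike \<open>pd\<close>, which is total, this relation also records that the derivative
  exists, so its rules compose.\<close>

definition has_pd :: "'n::finite \<Rightarrow> (real ^ 'n \<Rightarrow> real) \<Rightarrow> real \<Rightarrow> real ^ 'n \<Rightarrow> bool" where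
  "has_pd i f d y \<longleftrightarrow> ((\<lambda>t. f (y + t *\<^sub>R axis i 1)) has_real_derivative d) (at 0)"

lemma has_pd_imp_pd: "has_pd i f d y \<Longrightarrow> pd i f y = d"
  by (simp add: has_pd_def pd_def DERIV_imp_deriv)

text \<open>Lets the differentiation rules produce a raw value first; its equality with the intended
  closed form is left as a separate algebraic goal.\<close>

lemma has_pd_eq: "has_pd i f d y \<Longrightarrow> d = d' \<Longrightarrow> has_pd i f d' y"
  by simp

text \<open>Closed forms of iterated partial derivatives hold only on an open domain. This rule
  allows differentiating the closed form in place of the function itself.\<close>

lemma has_pd_cong:
  assumes "has_pd i f d y" "open D" "y \<in> D" "\<And>z. z \<in> D \<Longrightarrow> f z = g z"
  shows "has_pd i g d y"
proof -
  let ?S = "(\<lambda>t::real. y + t *\<^sub>R axis i 1) -` D"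
  have "open ?S"
    by (intro continuous_open_vimage continuous_intros assms(2))
  then show ?thesis
    using assms unfolding has_pd_def
    by (elim has_field_derivative_transform_within_open[of _ _ _ ?S]) auto
qed

lemma has_pd_const: "has_pd i (\<lambda>_. c) 0 y"
  by (simp add: has_pd_def)

lemma has_pd_add: "has_pd i f d y \<Longrightarrow> has_pd i g e y \<Longrightarrow> has_pd i (\<lambda>z. f z + g z) (d + e) y"
  unfolding has_pd_def by (rule DERIV_add)

lemma has_pd_diff: "has_pd i f d y \<Longrightarrow> has_pd i g e y \<Longrightarrow> has_pd i (\<lambda>z. f z - g z) (d - e) y"
  unfolding has_pd_def by (rule DERIV_diff)

lemma has_pd_mult:
  "has_pd i f d y \<Longrightarrow> has_pd i g e y \<Longrightarrow> has_pd i (\<lambda>z. f z * g z) (d * g y + e * f y) y"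
  unfolding has_pd_def by (drule (1) DERIV_mult) simp

lemma has_pd_divide:
  "has_pd i f d y \<Longrightarrow> has_pd i g e y \<Longrightarrow> g y \<noteq> 0 \<Longrightarrow>
    has_pd i (\<lambda>z. f z / g z) ((d * g y - f y * e) / (g y * g y)) y"
  unfolding has_pd_def
  using DERIV_divide[of "\<lambda>t. f (y + t *\<^sub>R axis i 1)" d 0 UNIV "\<lambda>t. g (y + t *\<^sub>R axis i 1)" e] by simp

lemma has_pd_compose:
  "(g has_real_derivative e) (at (f y)) \<Longrightarrow> has_pd i f d y \<Longrightarrow> has_pd i (\<lambda>z. g (f z)) (e * d) y"
  unfolding has_pd_def
  using DERIV_chain2[of g e "\<lambda>t. f (y + t *\<^sub>R axis i 1)" 0 d UNIV] by simp

lemmas has_pd_intros = has_pd_const has_pd_add has_pd_diff has_pd_mult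

section \<open>Inverse matrices\<close>

text \<open>Applies the inverse of g to a covector once a preimage is known, so the entries of that
  inverse are never computed.\<close>

lemma matrix_inv_vec_eqI:
  fixes G :: "real ^ 'n ^ 'n"
  assumes "invertible G" "G *v v = w"
  shows "matrix_inv G *v w = v"
proof -
  have "matrix_inv G ** G = mat 1"
    using someI_ex[OF assms(1)[unfolded invertible_def]] by (simp add: matrix_inv_def)
  then show ?thesis
    using assms(2) by (metis matrix_vector_mul_assoc matrix_vector_mul_lid)
qed

lemma posdef_invertible:
  fixes A :: "real ^ 'n ^ 'n"
  assumes "\<And>v. v \<noteq> 0 \<Longrightarrow> v \<bullet> (A *v v) > 0"
  shows "invertible A"
proof -
  have "v = 0" if "A *v v = 0" for v
    using assms[of v] that by auto
  then show ?thesis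
    using invertible_left_inverse matrix_left_invertible_ker by blast
qed

lemma alpha_eq: "alpha A y = sqrt (y \<bullet> (A *v y))"
  by (simp add: alpha_def inner_vec_def matrix_vector_mult_def sum_distrib_left mult_ac)

lemma beta_eq: "beta B y = B \<bullet> y"
  by (simp add: beta_def inner_vec_def)

section \<open>Derivatives of \<alpha>, s and the tensors built from them\<close>

text \<open>The T-tensor differentiates in y alone, so at a fixed point and in a fixed chart the
  metric and the 1-form are a constant matrix and a constant vector.\<close>

locale ab_point =
  fixes A :: "real ^ 'n::finite ^ 'n" and B :: "real ^ 'n" and \<phi> :: "real \<Rightarrow> real" and J :: "real set"
  assumes sym: "transpose A = A"
    and pos: "v \<noteq> 0 \<Longrightarrow> v \<bullet> (A *v v) > 0"
    and open_J: "open J"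
    and smooth: "smooth_on J \<phi>"
    and phi_pos: "t \<in> J \<Longrightarrow> \<phi> t > 0"
begin

abbreviation "D \<equiv> ab_domain J A B"
abbreviation "al \<equiv> alpha A"
abbreviation "s \<equiv> s_var A B"

text \<open>These are \<alpha>_i, m_i and the rows of h_ij in closed form, without
  \<open>pd\<close>. As vectors they turn contractions into inner products; \<open>m_low_eq\<close>
  and \<open>h_low_eq\<close> link them to the official definitions away from the origin.\<close>

definition av :: "real ^ 'n \<Rightarrow> real ^ 'n" where "av y = (1 / al y) *\<^sub>R (A *v y)"
definition mv :: "real ^ 'n \<Rightarrow> real ^ 'n" where "mv y = B - s y *\<^sub>R av y"
definition hv :: "'n \<Rightarrow> real ^ 'n \<Rightarrow> real ^ 'n" where "hv i y = A $ i - (av y $ i) *\<^sub>R av y"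

lemma A_comm: "A $ i $ j = A $ j $ i"
  using arg_cong[OF sym, of "\<lambda>M. M $ i $ j"] by (simp add: transpose_def)

lemma inner_A_comm: "x \<bullet> (A *v y) = y \<bullet> (A *v x)"
  by (metis dot_lmul_matrix inner_commute sym transpose_matrix_vector)

lemma al_pos: "y \<noteq> 0 \<Longrightarrow> al y > 0"
  by (simp add: alpha_eq pos)

lemma al_sq: "al y * al y = y \<bullet> (A *v y)"
  by (cases "y = 0") (auto simp: alpha_eq pos less_imp_le)

lemma D_nz: "y \<in> D \<Longrightarrow> y \<noteq> 0" and D_J: "y \<in> D \<Longrightarrow> s y \<in> J"
  by (auto simp: ab_domain_def)

lemma al_D_pos: "y \<in> D \<Longrightarrow> al y > 0"
  using D_nz al_pos by blast

text \<open>Since \<alpha> vanishes only at the origin, s is continuous elsewhere. Openness is what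
  \<open>has_pd_cong\<close> requires.\<close>

lemma open_D: "open D"
proof -
  have "continuous_on (- {0}) s"
    unfolding s_var_def[abs_def] alpha_eq beta_eq
    by (intro continuous_intros linear_continuous_on matrix_vector_mul_bounded_linear)
      (use pos in fastforce)
  then have "open (s -` J \<inter> - {0})"
    using continuous_on_open_vimage[of "- {0}" s] open_J by auto
  also have "s -` J \<inter> - {0} = D" by (auto simp: ab_domain_def)
  finally show ?thesis .
qed

lemma has_pd_Av: "has_pd i (\<lambda>z. (A *v z) $ j) (A $ i $ j) y"
proof -
  have "(A *v (y + t *\<^sub>R axis i 1)) $ j = (A *v y) $ j + t * A $ i $ j" for t
    by (simp add: algebra_simps matrix_vector_mult_basis column_def A_comm[of j i] matrix_vector_mult_scaleR)
  then show ?thesis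
    unfolding has_pd_def by (auto intro!: derivative_eq_intros)
qed

lemma has_pd_alpha:
  assumes "y \<noteq> 0"
  shows "has_pd i al (av y $ i) y"
proof -
  let ?e = "axis i 1 :: real ^ 'n"
  have e: "?e \<bullet> (A *v z) = (A *v z) $ i" for z
    by (simp add: inner_axis')
  \<comment> \<open>Along a coordinate line \<alpha> is the root of a quadratic polynomial in t, and
    its derivative at 0 comes from the linear coefficient.\<close>
  have q: "(y + t *\<^sub>R ?e) \<bullet> (A *v (y + t *\<^sub>R ?e)) =
      y \<bullet> (A *v y) + t * (2 * (A *v y) $ i) + t * t * (?e \<bullet> (A *v ?e))" for t
    by (simp add: matrix_vector_right_distrib matrix_vector_mult_scaleR inner_add_left
        inner_add_right inner_A_comm[of y ?e] e algebra_simps)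
  show ?thesis
    unfolding has_pd_def alpha_eq q
    using pos[OF assms]
    by (auto intro!: derivative_eq_intros simp: av_def alpha_eq field_simps)
qed

lemma has_pd_s:
  assumes "y \<noteq> 0"
  shows "has_pd i s (mv y $ i / al y) y"
proof -
  have b: "has_pd i (\<lambda>z. B \<bullet> z) (B $ i) y"
    by (auto intro!: derivative_eq_intros simp: has_pd_def inner_add_right inner_axis)
  show ?thesis
    unfolding s_var_def[abs_def] beta_eq
    by (rule has_pd_eq[OF has_pd_divide[OF b has_pd_alpha[OF assms]]])
       (use al_pos[OF assms] in \<open>auto simp: mv_def s_var_def beta_eq field_simps\<close>)
qed

lemma has_pd_av:
  assumes "y \<noteq> 0"
  shows "has_pd j (\<lambda>z. av z $ i) (hv i y $ j / al y) y"
proof -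
  have "has_pd j (\<lambda>z. (A *v z) $ i / al z) (hv i y $ j / al y) y"
    by (rule has_pd_eq[OF has_pd_divide[OF has_pd_Av has_pd_alpha[OF assms]]])
       (use al_pos[OF assms] in \<open>auto simp: hv_def av_def A_comm[of i j] field_simps\<close>)
  then show ?thesis by (simp add: av_def)
qed

lemma hv_comm: "hv i y $ j = hv j y $ i"
  by (simp add: hv_def A_comm[of i j])

lemma pd_alpha: "y \<noteq> 0 \<Longrightarrow> pd i al y = av y $ i"
  by (rule has_pd_imp_pd[OF has_pd_alpha])

lemma h_low_eq: "y \<noteq> 0 \<Longrightarrow> h_low A i j y = hv i y $ j"
  by (simp add: h_low_def hv_def pd_alpha)

lemma m_low_eq: "y \<noteq> 0 \<Longrightarrow> m_low A B i y = mv y $ i"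
  by (simp add: m_low_def mv_def pd_alpha)

lemma has_pd_mv:
  assumes "y \<noteq> 0"
  shows "has_pd j (\<lambda>z. mv z $ i) (- (mv y $ j * av y $ i + s y * hv i y $ j) / al y) y"
proof -
  have "has_pd j (\<lambda>z. B $ i - s z * av z $ i) (- (mv y $ j * av y $ i + s y * hv i y $ j) / al y) y"
    by (rule has_pd_eq, (rule has_pd_intros has_pd_s has_pd_av assms)+)
       (use al_pos[OF assms] in \<open>simp add: field_simps\<close>)
  then show ?thesis by (simp add: mv_def)
qed

lemma has_pd_hv:
  assumes "y \<noteq> 0"
  shows "has_pd k (\<lambda>z. hv i z $ j) (- (hv i y $ k * av y $ j + hv j y $ k * av y $ i) / al y) y"
proof -
  have "has_pd k (\<lambda>z. A $ i $ j - av z $ i * av z $ j)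
     (- (hv i y $ k * av y $ j + hv j y $ k * av y $ i) / al y) y"
    by (rule has_pd_eq, (rule has_pd_intros has_pd_av assms)+)
       (use al_pos[OF assms] in \<open>simp add: field_simps\<close>)
  then show ?thesis by (simp add: hv_def)
qed

section \<open>One-variable derivatives of the coefficient functions\<close>

abbreviation "\<phi>1 \<equiv> deriv \<phi>"
abbreviation "\<phi>2 \<equiv> deriv (deriv \<phi>)"
abbreviation "r0 \<equiv> rho0 \<phi>"
abbreviation "r1 \<equiv> rho1 \<phi>"
abbreviation "r \<equiv> rho \<phi>"

lemma DERIV_phi:
  assumes "t \<in> J"
  shows "(\<phi> has_real_derivative \<phi>1 t) (at t)"
    and "(\<phi>1 has_real_derivative \<phi>2 t) (at t)"
    and "(\<phi>2 has_real_derivative deriv \<phi>2 t) (at t)"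
    and "(deriv \<phi>2 has_real_derivative deriv (deriv \<phi>2) t) (at t)"
proof -
  \<comment> \<open>Order four suffices: the second derivative of \<open>rho0\<close>, which enters
    \<Omega>, contains the fourth derivative of \<phi>.\<close>
  have C: "Ck_on 4 J \<phi>" using smooth by (simp add: smooth_on_def)
  note * = Ck_on_Suc_real[OF open_J]
  have C1: "Ck_on (Suc 3) J \<phi>" using C by (simp add: eval_nat_numeral)
  have C2: "Ck_on (Suc 2) J \<phi>1" using *(2)[OF C1] by (simp add: eval_nat_numeral)
  have C3: "Ck_on (Suc 1) J \<phi>2" using *(2)[OF C2] by (simp add: eval_nat_numeral)
  have C4: "Ck_on (Suc 0) J (deriv \<phi>2)" using *(2)[OF C3] by (simp add: eval_nat_numeral)
  show "(\<phi> has_real_derivative \<phi>1 t) (at t)"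
    and "(\<phi>1 has_real_derivative \<phi>2 t) (at t)"
    and "(\<phi>2 has_real_derivative deriv \<phi>2 t) (at t)"
    and "(deriv \<phi>2 has_real_derivative deriv (deriv \<phi>2) t) (at t)"
    using *(1)[OF C1 assms] *(1)[OF C2 assms] *(1)[OF C3 assms] *(1)[OF C4 assms] by auto
qed

lemma DERIV_rho0:
  assumes "t \<in> J"
  shows "(r0 has_real_derivative deriv r0 t) (at t)"
    and "(deriv r0 has_real_derivative deriv (deriv r0) t) (at t)"
proof -
  let ?d = "\<lambda>t. 3 * \<phi>1 t * \<phi>2 t + \<phi> t * deriv \<phi>2 t"
  have D: "(r0 has_real_derivative ?d t) (at t)" if "t \<in> J" for t
    unfolding rho0_def[abs_def] using DERIV_phi[OF that]
    by (auto intro!: derivative_eq_intros simp: power2_eq_square algebra_simps)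
  then show "(r0 has_real_derivative deriv r0 t) (at t)"
    using assms DERIV_imp_deriv by fastforce
  \<comment> \<open>Only existence is extracted here; the value stays in the form
    \<open>deriv (deriv r0) t\<close>, as in \<Omega>.\<close>
  have "\<exists>e. (?d has_real_derivative e) (at t)"
    using DERIV_phi[OF assms] by (auto intro!: exI derivative_eq_intros)
  then obtain e where "(?d has_real_derivative e) (at t)" ..
  then have "(deriv r0 has_real_derivative e) (at t)"
    by (rule has_field_derivative_transform_within_open[OF _ open_J assms])
       (simp add: DERIV_imp_deriv[OF D])
  then show "(deriv r0 has_real_derivative deriv (deriv r0) t) (at t)"
    using DERIV_imp_deriv by fastforce
qed

lemma DERIV_rho:
  assumes "t \<in> J"
  shows "(r has_real_derivative r1 t) (at t)"
    and "((\<lambda>t. \<phi> t * \<phi>1 t) has_real_derivative r0 t) (at t)"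
  unfolding rho_def[abs_def] rho1_def rho0_def using DERIV_phi[OF assms]
  by (auto intro!: derivative_eq_intros simp: power2_eq_square algebra_simps)

text \<open>In \<phi> \<phi>' - t \<open>rho0\<close>, the derivative of the first product is
  \<open>rho0\<close>, which cancels the term from differentiating the factor t.\<close>

lemma DERIV_rho1:
  assumes "t \<in> J"
  shows "(r1 has_real_derivative - t * deriv r0 t) (at t)"
proof -
  have "r1 = (\<lambda>t. \<phi> t * \<phi>1 t - t * r0 t)"
    by (simp add: fun_eq_iff rho1_def rho0_def)
  then show ?thesis
    using DERIV_diff[OF DERIV_rho(2)[OF assms] DERIV_mult[OF DERIV_ident DERIV_rho0(1)[OF assms]]]
    by (simp add: mult.commute)
qed

lemma has_pd_comp_s:
  "y \<in> D \<Longrightarrow> (g has_real_derivative e) (at (s y)) \<Longrightarrow> has_pd i (\<lambda>z. g (s z)) (e * (mv y $ i / al y)) y"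
  by (rule has_pd_compose[OF _ has_pd_s]) (auto dest: D_nz)


section \<open>The fundamental tensor, the Cartan tensor and its derivative\<close>

abbreviation "F \<equiv> ab_metric \<phi> A B"

lemma has_pd_coeffs:
  assumes "y \<in> D"
  shows "has_pd i (\<lambda>z. \<phi> (s z)) (\<phi>1 (s y) * (mv y $ i / al y)) y"
    and "has_pd i (\<lambda>z. \<phi> (s z) * \<phi>1 (s z)) (r0 (s y) * (mv y $ i / al y)) y"
    and "has_pd i (\<lambda>z. r (s z)) (r1 (s y) * (mv y $ i / al y)) y"
    and "has_pd i (\<lambda>z. r0 (s z)) (deriv r0 (s y) * (mv y $ i / al y)) y"
    and "has_pd i (\<lambda>z. r1 (s z)) (- s y * deriv r0 (s y) * (mv y $ i / al y)) y"
    and "has_pd i (\<lambda>z. deriv r0 (s z)) (deriv (deriv r0) (s y) * (mv y $ i / al y)) y"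
  using has_pd_comp_s[OF assms DERIV_phi(1)[OF D_J[OF assms]]]
    has_pd_comp_s[OF assms DERIV_rho(2)[OF D_J[OF assms]]]
    has_pd_comp_s[OF assms DERIV_rho(1)[OF D_J[OF assms]]]
    has_pd_comp_s[OF assms DERIV_rho0(1)[OF D_J[OF assms]]]
    has_pd_comp_s[OF assms DERIV_rho1(1)[OF D_J[OF assms]]]
    has_pd_comp_s[OF assms DERIV_rho0(2)[OF D_J[OF assms]]]
  by simp_all

lemma rho1_eq: "r1 t = \<phi> t * \<phi>1 t - t * r0 t"
  by (simp add: rho1_def rho0_def)

lemma has_pd_F:
  assumes "y \<in> D"
  shows "has_pd i F (\<phi> (s y) * av y $ i + \<phi>1 (s y) * mv y $ i) y"
  unfolding ab_metric_def[abs_def]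
  by (rule has_pd_eq, (rule has_pd_intros has_pd_coeffs has_pd_alpha D_nz assms)+)
     (use al_D_pos[OF assms] in \<open>simp add: field_simps\<close>)

text \<open>Substituting m_j = b_j - s \<alpha>_j turns the coefficient \<phi>^2 of \<alpha>_j into
  \<rho>. The form with b_j is kept because b_j is constant in y.\<close>

lemma pd_F_sq:
  assumes "y \<in> D"
  shows "pd j (\<lambda>z. (F z)\<^sup>2) y = 2 * al y * (r (s y) * av y $ j + \<phi> (s y) * \<phi>1 (s y) * B $ j)"
proof -
  have "has_pd j (\<lambda>z. F z * F z)
    (2 * al y * (r (s y) * av y $ j + \<phi> (s y) * \<phi>1 (s y) * B $ j)) y"
    by (rule has_pd_eq, (rule has_pd_intros has_pd_F assms)+)
       (simp add: ab_metric_def rho_def mv_def power2_eq_square algebra_simps)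
  then show ?thesis by (simp add: has_pd_imp_pd power2_eq_square)
qed

lemma fund_tensor_eq:
  assumes "y \<in> D"
  shows "fund_tensor F i j y = r (s y) * A $ i $ j + r0 (s y) * B $ i * B $ j
    + r1 (s y) * (B $ i * av y $ j + B $ j * av y $ i) - s y * r1 (s y) * av y $ i * av y $ j"
    (is "_ = ?g")
proof -
  have "has_pd i (\<lambda>z. 2 * al z * (r (s z) * av z $ j + \<phi> (s z) * \<phi>1 (s z) * B $ j)) (2 * ?g) y"
    by (rule has_pd_eq, (rule has_pd_coeffs has_pd_intros has_pd_alpha has_pd_av D_nz assms)+)
       (use al_D_pos[OF assms] in
         \<open>simp add: field_simps mv_def hv_def rho1_eq A_comm[of i j]\<close>)
  then have "has_pd i (pd j (\<lambda>z. (F z)\<^sup>2)) (2 * ?g) y"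
    by (rule has_pd_cong[OF _ open_D assms]) (simp add: pd_F_sq)
  then show ?thesis by (simp add: fund_tensor_def has_pd_imp_pd)
qed

text \<open>By \<open>rho1\<close>' = - s \<open>rho0\<close>', the terms with \<open>rho0\<close>'
  form the product (b_i - s \<alpha>_i)(b_j - s \<alpha>_j) = m_i m_j. Those with
  \<open>rho1\<close> combine to h_ij m_k from a_ij - \<alpha>_i \<alpha>_j, and to the other two
  products from the derivatives of \<alpha>_i and \<alpha>_j.\<close>

lemma cartan_eq:
  assumes "y \<in> D"
  shows "cartan F i j k y =
    (r1 (s y) * (hv i y $ j * mv y $ k + hv i y $ k * mv y $ j + hv j y $ k * mv y $ i)
      + deriv r0 (s y) * mv y $ i * mv y $ j * mv y $ k) / (2 * al y)"
    (is "_ = ?c / (2 * al y)")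
proof -
  have "has_pd k (\<lambda>z. r (s z) * A $ i $ j + r0 (s z) * B $ i * B $ j
    + r1 (s z) * (B $ i * av z $ j + B $ j * av z $ i) - s z * r1 (s z) * av z $ i * av z $ j)
    (?c / al y) y"
    by (rule has_pd_eq, (rule has_pd_coeffs has_pd_intros has_pd_s has_pd_av D_nz assms)+)
       (use al_D_pos[OF assms] in \<open>simp add: field_simps mv_def hv_def\<close>)
  then have "has_pd k (fund_tensor F i j) (?c / al y) y"
    by (rule has_pd_cong[OF _ open_D assms]) (simp add: fund_tensor_eq)
  then show ?thesis by (simp add: cartan_def has_pd_imp_pd)
qed

text \<open>The factor clears the denominators, and the last group comes from differentiating
  1/\<alpha>. Terms containing \<open>av\<close> are left as they are: in the T-tensor they cancel
  against the \<alpha>_i part of \<ell>_i.\<close>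

lemma pd_cartan:
  assumes "y \<in> D"
  shows "2 * (al y)\<^sup>2 * pd l (cartan F i j k) y =
    - s y * deriv r0 (s y) * mv y $ l *
        (hv i y $ j * mv y $ k + hv i y $ k * mv y $ j + hv j y $ k * mv y $ i)
    - r1 (s y) * ((hv i y $ l * av y $ j + hv j y $ l * av y $ i) * mv y $ k
        + hv i y $ j * (mv y $ l * av y $ k + s y * hv k y $ l)
        + (hv i y $ l * av y $ k + hv k y $ l * av y $ i) * mv y $ j
        + hv i y $ k * (mv y $ l * av y $ j + s y * hv j y $ l)
        + (hv j y $ l * av y $ k + hv k y $ l * av y $ j) * mv y $ i
        + hv j y $ k * (mv y $ l * av y $ i + s y * hv i y $ l))
    + deriv (deriv r0) (s y) * mv y $ l * mv y $ i * mv y $ j * mv y $ k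
    - deriv r0 (s y) * ((mv y $ l * av y $ i + s y * hv i y $ l) * mv y $ j * mv y $ k
        + (mv y $ l * av y $ j + s y * hv j y $ l) * mv y $ i * mv y $ k
        + (mv y $ l * av y $ k + s y * hv k y $ l) * mv y $ i * mv y $ j)
    - av y $ l * (r1 (s y) * (hv i y $ j * mv y $ k + hv i y $ k * mv y $ j + hv j y $ k * mv y $ i)
      + deriv r0 (s y) * mv y $ i * mv y $ j * mv y $ k)"
    (is "_ = ?d - av y $ l * ?N y")
proof -
  have a: "al y > 0" by (rule al_D_pos[OF assms])
  have N: "has_pd l ?N (?d / al y) y"
    by (rule has_pd_eq,
        (rule has_pd_coeffs has_pd_intros has_pd_av has_pd_hv has_pd_mv D_nz assms)+)
       (use a in \<open>simp add: field_simps\<close>)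
  have "has_pd l (\<lambda>z. 2 * al z) (2 * av y $ l) y"
    by (rule has_pd_eq, (rule has_pd_intros has_pd_alpha D_nz assms)+) simp
  then have "has_pd l (\<lambda>z. ?N z / (2 * al z)) ((?d - av y $ l * ?N y) / (2 * (al y)\<^sup>2)) y"
    by (rule has_pd_eq[OF has_pd_divide[OF N]]) (use a in \<open>simp_all add: power2_eq_square divide_simps\<close>)
  then have "has_pd l (cartan F i j k) ((?d - av y $ l * ?N y) / (2 * (al y)\<^sup>2)) y"
    by (rule has_pd_cong[OF _ open_D assms]) (simp add: cartan_eq)
  then show ?thesis
    using a by (simp add: has_pd_imp_pd)
qed

section \<open>Raising indices with the Riemannian metric\<close>

text \<open>\<open>Mu\<close>, \<open>Hu i\<close> and, below, \<open>Wu i j\<close> are \<open>mv\<close>, \<open>hv i\<close> and the Cartan covector \<open>Cv i j\<close> with the index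
  raised by the inverse of \<open>A\<close>; \<open>mW i j\<close> is the pairing of \<open>mv\<close> with \<open>Wu i j\<close>.\<close>

definition Mu :: "real ^ 'n \<Rightarrow> real ^ 'n" where
  "Mu y = matrix_inv A *v B - (s y / al y) *\<^sub>R y"
definition Hu :: "'n \<Rightarrow> real ^ 'n \<Rightarrow> real ^ 'n" where
  "Hu i y = axis i 1 - (av y $ i / al y) *\<^sub>R y"

lemma inner_B_y: "B \<bullet> y = s y * al y"
  using al_pos[of y] by (cases "y = 0") (auto simp: s_var_def beta_eq)

lemma b_sq_eq: "b_sq A B = B \<bullet> (matrix_inv A *v B)"
  by (simp add: b_sq_def b_up_def inner_vec_def matrix_vector_mult_def mult_ac)

lemma inner_av: "av y \<bullet> x = (y \<bullet> (A *v x)) / al y"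
  by (simp add: av_def inner_commute[of _ x] inner_A_comm[of x y])

lemma inner_hv: "hv i y \<bullet> x = (A *v x) $ i - av y $ i * (av y \<bullet> x)"
  by (simp add: hv_def inner_diff_left matrix_vector_mul_component)

text \<open>These are Euler's relations: \<alpha> is homogeneous of degree 1, while s and
  \<alpha>_i, whose derivatives are m_i / \<alpha> and h_ij / \<alpha>, have degree 0.\<close>

lemma inner_y:
  assumes "y \<noteq> 0"
  shows "av y \<bullet> y = al y" "mv y \<bullet> y = 0" "hv i y \<bullet> y = 0"
proof -
  show a: "av y \<bullet> y = al y"
    using al_pos[OF assms] by (simp add: inner_av al_sq[symmetric])
  show "mv y \<bullet> y = 0"
    by (simp add: mv_def inner_diff_left a inner_B_y)
  show "hv i y \<bullet> y = 0"
    using al_pos[OF assms] by (simp add: inner_hv a) (simp add: av_def)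
qed

lemma A_Mu:
  assumes "y \<noteq> 0"
  shows "A *v Mu y = mv y"
proof -
  have "invertible A" by (rule posdef_invertible) (rule pos)
  then have "A ** matrix_inv A = mat 1"
    using someI_ex[of "\<lambda>A'. A ** A' = mat 1 \<and> A' ** A = mat 1"]
    by (simp add: matrix_inv_def invertible_def)
  then show ?thesis
    by (simp add: Mu_def mv_def av_def matrix_vector_mult_diff_distrib matrix_vector_mult_scaleR
        matrix_vector_mul_assoc)
qed

lemma A_Hu: "y \<noteq> 0 \<Longrightarrow> A *v Hu i y = hv i y"
  by (simp add: Hu_def hv_def matrix_vector_mult_diff_distrib matrix_vector_mult_scaleR vec_eq_iff
      matrix_vector_mult_basis column_def A_comm[of _ i] av_def)

text \<open>Lowering \<open>Mu y\<close> gives \<open>mv y\<close>, which annihilates y. So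
  \<open>Mu y\<close> is orthogonal to y with respect to \<open>A\<close>, and on such vectors h
  acts like \<open>A\<close>.\<close>

lemma inner_Mu:
  assumes "y \<noteq> 0"
  shows "av y \<bullet> Mu y = 0" "hv i y \<bullet> Mu y = mv y $ i" "mv y \<bullet> Mu y = m_sq A B y"
proof -
  show a: "av y \<bullet> Mu y = 0"
    using inner_y[OF assms] by (simp add: inner_av A_Mu[OF assms] inner_commute)
  show "hv i y \<bullet> Mu y = mv y $ i"
    by (simp add: inner_hv a A_Mu[OF assms])
  show "mv y \<bullet> Mu y = m_sq A B y"
    using al_pos[OF assms] by (simp add: mv_def inner_diff_left a)
      (simp add: Mu_def inner_diff_right inner_B_y m_sq_def b_sq_eq power2_eq_square)
qed

lemma inner_Hu:
  assumes "y \<noteq> 0"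
  shows "av y \<bullet> Hu i y = 0" "hv j y \<bullet> Hu i y = hv i y $ j" "mv y \<bullet> Hu i y = mv y $ i"
proof -
  show a: "av y \<bullet> Hu i y = 0"
    using inner_y[OF assms] by (simp add: inner_av A_Hu[OF assms] inner_commute)
  show "hv j y \<bullet> Hu i y = hv i y $ j"
    by (simp add: inner_hv a A_Hu[OF assms])
  show "mv y \<bullet> Hu i y = mv y $ i"
    using al_pos[OF assms] by (simp add: mv_def inner_diff_left a)
      (simp add: Hu_def inner_diff_right inner_B_y inner_axis)
qed


definition mW :: "'n \<Rightarrow> 'n \<Rightarrow> real ^ 'n \<Rightarrow> real" where
  "mW i j y = (r1 (s y) * (2 * mv y $ i * mv y $ j + hv i y $ j * m_sq A B y)
     + deriv r0 (s y) * mv y $ i * mv y $ j * m_sq A B y) / (2 * al y)"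

definition Wu :: "'n \<Rightarrow> 'n \<Rightarrow> real ^ 'n \<Rightarrow> real ^ 'n" where
  "Wu i j y = (1 / (2 * al y)) *\<^sub>R (r1 (s y) *\<^sub>R (mv y $ j *\<^sub>R Hu i y + mv y $ i *\<^sub>R Hu j y)
     + (r1 (s y) * hv i y $ j + deriv r0 (s y) * mv y $ i * mv y $ j) *\<^sub>R Mu y)"

definition Cv :: "'n \<Rightarrow> 'n \<Rightarrow> real ^ 'n \<Rightarrow> real ^ 'n" where
  "Cv i j y = (1 / (2 * al y)) *\<^sub>R (r1 (s y) *\<^sub>R (mv y $ j *\<^sub>R hv i y + mv y $ i *\<^sub>R hv j y)
     + (r1 (s y) * hv i y $ j + deriv r0 (s y) * mv y $ i * mv y $ j) *\<^sub>R mv y)"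

lemma cartan_Cv: "y \<in> D \<Longrightarrow> cartan F l i j y = Cv i j y $ l"
  by (simp add: cartan_eq Cv_def hv_comm[of l] algebra_simps add_divide_distrib)

lemma inner_Wu:
  assumes "y \<noteq> 0"
  shows "av y \<bullet> Wu i j y = 0" "hv l y \<bullet> Wu i j y = Cv i j y $ l" "mv y \<bullet> Wu i j y = mW i j y"
  using al_pos[OF assms]
  by (simp_all add: Wu_def Cv_def mW_def inner_add_right inner_Mu inner_Hu assms field_simps hv_comm[of l])

text \<open>The third identity is the product of two Cartan tensors contracted with the inverse of
  \<open>A\<close>, the first ingredient of the contraction with the inverse of g.\<close>

lemma inner_Cv:
  assumes "y \<noteq> 0"
  shows "Cv i j y \<bullet> y = 0" "Cv i j y \<bullet> Mu y = mW i j y"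
    "4 * (al y)\<^sup>2 * (Cv i j y \<bullet> Wu h k y) =
      (r1 (s y))\<^sup>2 * (hv i y $ j * hv h y $ k * m_sq A B y + 2 * hv i y $ j * mv y $ h * mv y $ k
         + 2 * mv y $ i * mv y $ j * hv h y $ k
         + hv i y $ h * mv y $ j * mv y $ k + hv i y $ k * mv y $ j * mv y $ h
         + hv j y $ h * mv y $ i * mv y $ k + hv j y $ k * mv y $ i * mv y $ h)
      + r1 (s y) * deriv r0 (s y) * (hv i y $ j * mv y $ h * mv y $ k * m_sq A B y
         + mv y $ i * mv y $ j * hv h y $ k * m_sq A B y + 4 * mv y $ i * mv y $ j * mv y $ h * mv y $ k)
      + (deriv r0 (s y))\<^sup>2 * mv y $ i * mv y $ j * mv y $ h * mv y $ k * m_sq A B y"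
proof -
  show "Cv i j y \<bullet> y = 0"
    by (simp add: Cv_def inner_add_left inner_y assms)
  show "Cv i j y \<bullet> Mu y = mW i j y"
    by (simp add: Cv_def mW_def inner_add_left inner_Mu assms algebra_simps add_divide_distrib)
  have "2 * al y * (Cv i j y \<bullet> Wu h k y) = r1 (s y) * (mv y $ j * Cv h k y $ i + mv y $ i * Cv h k y $ j)
     + (r1 (s y) * hv i y $ j + deriv r0 (s y) * mv y $ i * mv y $ j) * mW h k y"
    using al_pos[OF assms] by (simp add: Cv_def[of i j] inner_add_left inner_Wu assms)
  then have "4 * (al y)\<^sup>2 * (Cv i j y \<bullet> Wu h k y) =
     r1 (s y) * (mv y $ j * (2 * al y * Cv h k y $ i) + mv y $ i * (2 * al y * Cv h k y $ j))
     + (r1 (s y) * hv i y $ j + deriv r0 (s y) * mv y $ i * mv y $ j) * (2 * al y * mW h k y)"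
    by algebra
  also have "\<dots> = (r1 (s y))\<^sup>2 * (hv i y $ j * hv h y $ k * m_sq A B y + 2 * hv i y $ j * mv y $ h * mv y $ k
         + 2 * mv y $ i * mv y $ j * hv h y $ k
         + hv i y $ h * mv y $ j * mv y $ k + hv i y $ k * mv y $ j * mv y $ h
         + hv j y $ h * mv y $ i * mv y $ k + hv j y $ k * mv y $ i * mv y $ h)
      + r1 (s y) * deriv r0 (s y) * (hv i y $ j * mv y $ h * mv y $ k * m_sq A B y
         + mv y $ i * mv y $ j * hv h y $ k * m_sq A B y + 4 * mv y $ i * mv y $ j * mv y $ h * mv y $ k)
      + (deriv r0 (s y))\<^sup>2 * mv y $ i * mv y $ j * mv y $ h * mv y $ k * m_sq A B y"
    using al_pos[OF assms]
    by (simp add: Cv_def mW_def hv_comm[of h _ i] hv_comm[of h _ j] hv_comm[of k _ i] hv_comm[of k _ j])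
       algebra
  finally show "4 * (al y)\<^sup>2 * (Cv i j y \<bullet> Wu h k y) = \<dots>" .
qed

section \<open>Contraction of Cartan tensors with the inverse of g\<close>

text \<open>Inserting b = m + s \<alpha>_i and a_ij = h_ij + \<alpha>_i \<alpha>_j regroups g, with
  coefficients \<phi>^2, \<phi> \<phi>' and \<open>rho0\<close> beside \<rho>. Then g acts on v
  through pairings with \<open>hv\<close>, \<open>av\<close> and \<open>mv\<close> alone.\<close>

lemma fund_matrix_mult:
  assumes "y \<in> D"
  shows "(fund_matrix F y *v v) $ i = r (s y) * (hv i y \<bullet> v) + (\<phi> (s y))\<^sup>2 * av y $ i * (av y \<bullet> v)
    + \<phi> (s y) * \<phi>1 (s y) * (av y $ i * (mv y \<bullet> v) + mv y $ i * (av y \<bullet> v))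
    + r0 (s y) * mv y $ i * (mv y \<bullet> v)"
proof -
  have "fund_matrix F y $ i = r (s y) *\<^sub>R hv i y + ((\<phi> (s y))\<^sup>2 * av y $ i) *\<^sub>R av y
    + (\<phi> (s y) * \<phi>1 (s y)) *\<^sub>R (av y $ i *\<^sub>R mv y + mv y $ i *\<^sub>R av y)
    + (r0 (s y) * mv y $ i) *\<^sub>R mv y"
    by (simp add: vec_eq_iff fund_matrix_def fund_tensor_eq[OF assms])
       (simp add: hv_def mv_def rho_def rho1_eq power2_eq_square algebra_simps)
  then show ?thesis
    by (simp add: matrix_vector_mul_component inner_add_left algebra_simps)
qed

text \<open>Each expression is \<phi>, positive on \<open>J\<close>, times one of the scalar
  conditions in \<open>nondegenerate_at\<close>.\<close>

lemma rho_nz: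
  assumes "y \<in> D" "nondegenerate_at \<phi> A B y"
  shows "r (s y) \<noteq> 0" "r (s y) + \<phi> (s y) * \<phi>2 (s y) * m_sq A B y \<noteq> 0"
proof -
  have p: "\<phi> (s y) \<noteq> 0" using phi_pos[OF D_J[OF assms(1)]] by simp
  have "r (s y) = \<phi> (s y) * (\<phi> (s y) - s y * \<phi>1 (s y))"
    by (simp add: rho_def power2_eq_square algebra_simps)
  then show "r (s y) \<noteq> 0"
    using assms(2) p by (simp add: nondegenerate_at_def Let_def)
  have "r (s y) + \<phi> (s y) * \<phi>2 (s y) * m_sq A B y =
      \<phi> (s y) * (\<phi> (s y) - s y * \<phi>1 (s y) + (b_sq A B - (s y)\<^sup>2) * \<phi>2 (s y))"
    by (simp add: rho_def m_sq_def power2_eq_square algebra_simps)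
  then show "r (s y) + \<phi> (s y) * \<phi>2 (s y) * m_sq A B y \<noteq> 0"
    using assms(2) p by (simp add: nondegenerate_at_def Let_def)
qed

lemma cartan_contraction:
  assumes y: "y \<in> D" and nd: "nondegenerate_at \<phi> A B y"
  shows "(\<Sum>l\<in>UNIV. cartan F l i j y * cartan_up F l h k y) =
    (Cv i j y \<bullet> Wu h k y) / r (s y) + mu0 \<phi> (s y) (m_sq A B y) * mW i j y * mW h k y"
proof -
  define \<mu> where "\<mu> = mu0 \<phi> (s y) (m_sq A B y)"
  \<comment> \<open>This will be the pairing of \<open>mv y\<close> with the preimage
    \<open>V\<close>.\<close>
  define \<kappa> where "\<kappa> = mW h k y / r (s y) + \<mu> * mW h k y * m_sq A B y"
  \<comment> \<open>\<open>V\<close> is the candidate for the covector \<open>Cv h k y\<close>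
    raised by g. The multiple of y is chosen so that \<phi>^2 (av, V) + \<phi> \<phi>' (mv, V) = 0,
    which removes the \<open>av\<close> component of g V.\<close>
  define V where "V = (1 / r (s y)) *\<^sub>R Wu h k y + (\<mu> * mW h k y) *\<^sub>R Mu y
    - (\<phi>1 (s y) / \<phi> (s y) * \<kappa> / al y) *\<^sub>R y"
  note nz = D_nz[OF y] rho_nz[OF y nd]
  have p: "\<phi> (s y) \<noteq> 0" using phi_pos[OF D_J[OF y]] by simp
  have V: "hv l y \<bullet> V = Cv h k y $ l / r (s y) + \<mu> * mW h k y * mv y $ l"
    "mv y \<bullet> V = \<kappa>" "av y \<bullet> V = - (\<phi>1 (s y) / \<phi> (s y) * \<kappa>)" for l
    using al_D_pos[OF y] unfolding V_def
    by (simp_all add: inner_add_right inner_diff_right inner_Wu inner_Mu inner_y nz \<kappa>_def)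
  \<comment> \<open>The left side is the unwanted coefficient of m_l in g V. With
    \<open>rho0\<close> - \<phi>'^2 = \<phi> \<phi>'', its vanishing is the equation that
    \<open>mu0\<close> solves.\<close>
  have "r (s y) * \<mu> * mW h k y + (r0 (s y) - (\<phi>1 (s y))\<^sup>2) * \<kappa> = 0"
  proof -
    have m: "\<mu> * (r (s y) * (r (s y) + \<phi> (s y) * \<phi>2 (s y) * m_sq A B y)) = - (\<phi> (s y) * \<phi>2 (s y))"
      using nz by (simp add: \<mu>_def mu0_def)
    have k: "\<kappa> * r (s y) = mW h k y * (1 + r (s y) * \<mu> * m_sq A B y)"
      using nz by (simp add: \<kappa>_def field_simps)
    have "(r (s y) * \<mu> * mW h k y + (r0 (s y) - (\<phi>1 (s y))\<^sup>2) * \<kappa>) * r (s y) =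
       mW h k y * (\<mu> * (r (s y) * (r (s y) + \<phi> (s y) * \<phi>2 (s y) * m_sq A B y)) + \<phi> (s y) * \<phi>2 (s y))"
      unfolding rho0_def distrib_right mult.assoc k by (simp add: algebra_simps power2_eq_square)
    then show ?thesis using m nz by simp
  qed
  then have "(fund_matrix F y *v V) $ l = Cv h k y $ l" for l
    unfolding fund_matrix_mult[OF y] V using nz(2) p
    by (simp add: power2_eq_square field_simps) algebra
  then have "matrix_inv (fund_matrix F y) *v Cv h k y = V"
    using nd by (intro matrix_inv_vec_eqI) (auto simp: vec_eq_iff nondegenerate_at_def)
  then have "cartan_up F l h k y = V $ l" for l
    by (auto simp: cartan_up_def cartan_Cv[OF y] matrix_vector_mult_def)
  then have "(\<Sum>l\<in>UNIV. cartan F l i j y * cartan_up F l h k y) = Cv i j y \<bullet> V"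
    by (simp add: cartan_Cv[OF y] inner_vec_def)
  also have "\<dots> = (Cv i j y \<bullet> Wu h k y) / r (s y) + \<mu> * mW i j y * mW h k y"
    unfolding V_def by (simp add: inner_add_right inner_diff_right inner_Cv nz)
  finally show ?thesis by (simp add: \<mu>_def)
qed

section \<open>The coefficients and the assembly of the T-tensor\<close>

lemma K_eq:
  assumes "y \<in> D" "nondegenerate_at \<phi> A B y"
  shows "K1 \<phi> (al y) (s y) (m_sq A B y) =
      r1 (s y) / (2 * al y * (r (s y) + m_sq A B y * \<phi> (s y) * \<phi>2 (s y)))"
    and "K2 \<phi> (al y) (s y) (m_sq A B y) =
      (r (s y) * deriv r0 (s y) - 2 * r1 (s y) * \<phi> (s y) * \<phi>2 (s y))
        / (2 * al y * r (s y) * (r (s y) + m_sq A B y * \<phi> (s y) * \<phi>2 (s y)))"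
proof -
  define R where "R = r (s y)"
  define E where "E = R + \<phi> (s y) * \<phi>2 (s y) * m_sq A B y"
  define f where "f = \<phi> (s y) * \<phi>2 (s y)"
  have nz: "R \<noteq> 0" "E \<noteq> 0" "al y \<noteq> 0"
    using rho_nz[OF assms] al_D_pos[OF assms(1)] by (auto simp: R_def E_def)
  have mu: "mu0 \<phi> (s y) (m_sq A B y) = - f / (R * E)"
    by (simp add: mu0_def R_def E_def f_def)
  have E: "R + m_sq A B y * \<phi> (s y) * \<phi>2 (s y) = E"
    by (simp add: E_def algebra_simps)
  \<comment> \<open>This rewrites 1 + \<rho> \<open>mu0\<close> m^2 and so leads from the defining
    forms of K1 and K2 to the second ones.\<close>
  have one: "1 + R * (- f / (R * E)) * m_sq A B y = R / E"
    using nz by (simp add: field_simps) (simp add: E_def f_def)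
  show "K1 \<phi> (al y) (s y) (m_sq A B y) =
      r1 (s y) / (2 * al y * (r (s y) + m_sq A B y * \<phi> (s y) * \<phi>2 (s y)))"
    using nz unfolding K1_def mu R_def[symmetric] E one by simp
  show "K2 \<phi> (al y) (s y) (m_sq A B y) =
      (r (s y) * deriv r0 (s y) - 2 * r1 (s y) * \<phi> (s y) * \<phi>2 (s y))
        / (2 * al y * r (s y) * (r (s y) + m_sq A B y * \<phi> (s y) * \<phi>2 (s y)))"
    using nz unfolding K2_def mu R_def[symmetric] E one
    by (simp add: field_simps f_def)
qed

lemma T_tensor_eq:
  assumes y: "y \<in> D" and nd: "nondegenerate_at \<phi> A B y"
  shows "T_tensor F h i j k y =
     Phi_coeff \<phi> (al y) (s y) (m_sq A B y) *
       (hv h y $ i * hv j y $ k + hv h y $ j * hv i y $ k + hv h y $ k * hv i y $ j)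
     + Psi_coeff \<phi> (al y) (s y) (m_sq A B y) *
       (hv h y $ k * mv y $ i * mv y $ j + hv h y $ j * mv y $ i * mv y $ k
         + hv h y $ i * mv y $ j * mv y $ k + hv i y $ j * mv y $ h * mv y $ k
         + hv j y $ k * mv y $ i * mv y $ h + hv i y $ k * mv y $ j * mv y $ h)
     + Omega_coeff \<phi> (al y) (s y) (m_sq A B y) * (mv y $ h * mv y $ i * mv y $ j * mv y $ k)"
proof -
  \<comment> \<open>The reciprocals and \<open>mu0\<close> become opaque variables, so the final
    comparison is polynomial; the relation between \<alpha> and its reciprocal enters through
    \<open>au2\<close>.\<close>
  define u where "u = 1 / al y"
  define q where "q = 1 / r (s y)"
  define \<mu> where "\<mu> = mu0 \<phi> (s y) (m_sq A B y)"
  note nz = D_nz[OF y] rho_nz(1)[OF y nd]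
  have a: "al y > 0" by (rule al_D_pos[OF y])
  have au: "al y * u = 1" using a by (simp add: u_def)
  have pdC: "pd l (cartan F i j k) y = u\<^sup>2 / 2 * d" if "2 * (al y)\<^sup>2 * pd l (cartan F i j k) y = d" for l i j k d
    using that a by (auto simp: u_def field_simps)
  have cW: "Cv i j y \<bullet> Wu h k y = u\<^sup>2 / 4 * d" if "4 * (al y)\<^sup>2 * (Cv i j y \<bullet> Wu h k y) = d" for i j h k d
    using that a by (auto simp: u_def field_simps)
  have mWu: "mW i j y = u / 2 * (r1 (s y) * (2 * mv y $ i * mv y $ j + hv i y $ j * m_sq A B y)
     + deriv r0 (s y) * mv y $ i * mv y $ j * m_sq A B y)" for i j
    by (simp add: mW_def u_def)
  have K1u: "al y * K1 \<phi> (al y) (s y) (m_sq A B y) = r1 (s y) * (q + \<mu> * m_sq A B y) / 2"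
    using a nz by (simp add: K1_def q_def \<mu>_def field_simps)
  have K2u: "K2 \<phi> (al y) (s y) (m_sq A B y) =
     u * (deriv r0 (s y) * (q + \<mu> * m_sq A B y) / 2 + r1 (s y) * \<mu>)"
    using a nz by (simp add: K2_def q_def u_def \<mu>_def field_simps)
  have Phi: "Phi_coeff \<phi> (al y) (s y) (m_sq A B y) =
     - u / 2 * r1 (s y) * \<phi> (s y) * (s y + r1 (s y) * (q + \<mu> * m_sq A B y) / 2 * m_sq A B y)"
    unfolding Phi_coeff_def K1u by (simp add: u_def)
  have Psi: "Psi_coeff \<phi> (al y) (s y) (m_sq A B y) =
     u * r1 (s y) * \<phi>1 (s y) - u * q * (r1 (s y))\<^sup>2 * \<phi> (s y) - u / 2 * s y * deriv r0 (s y) * \<phi> (s y)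
     - r1 (s y) * \<phi> (s y) * m_sq A B y
         * (u * (deriv r0 (s y) * (q + \<mu> * m_sq A B y) / 2 + r1 (s y) * \<mu>)) / 2"
    unfolding Psi_coeff_def K2u by (simp add: u_def q_def)
  have Omega: "Omega_coeff \<phi> (al y) (s y) (m_sq A B y) =
     u / 2 * deriv (deriv r0) (s y) * \<phi> (s y) + 2 * u * deriv r0 (s y) * \<phi>1 (s y)
     - 3 * \<phi> (s y) * (u * (deriv r0 (s y) * (q + \<mu> * m_sq A B y) / 2 + r1 (s y) * \<mu>)
         * (r1 (s y) + deriv r0 (s y) * m_sq A B y / 2) + u * q / 2 * r1 (s y) * deriv r0 (s y))"
    unfolding Omega_coeff_def K2u by (simp add: u_def q_def mult_ac)
  have C: "cartan F i j k y = u / 2 *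
      (r1 (s y) * (hv i y $ j * mv y $ k + hv i y $ k * mv y $ j + hv j y $ k * mv y $ i)
      + deriv r0 (s y) * mv y $ i * mv y $ j * mv y $ k)" for i j k
    by (simp add: cartan_eq[OF y] u_def)
  \<comment> \<open>Fixes one order for the two indices of h, so that equal monomials
    coincide.\<close>
  have sym: "hv i y $ h = hv h y $ i" "hv j y $ h = hv h y $ j" "hv k y $ h = hv h y $ k"
    "hv j y $ i = hv i y $ j" "hv k y $ i = hv i y $ k" "hv k y $ j = hv j y $ k"
    by (rule hv_comm)+
  have cc: "(\<Sum>l\<in>UNIV. cartan F l i j y * cartan_up F l h k y) =
      q * (Cv i j y \<bullet> Wu h k y) + \<mu> * mW i j y * mW h k y" for i j h k
    using cartan_contraction[OF y nd] by (simp add: q_def \<mu>_def)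
  have au2: "al y * u\<^sup>2 = u" using au by algebra
  have scale1: "al y * \<phi> (s y) * (u\<^sup>2 / 2 * d) = u / 2 * (\<phi> (s y) * d)" for d
    using arg_cong[OF au2, of "\<lambda>x. x / 2 * (\<phi> (s y) * d)"] by (simp add: mult_ac)
  have scale2: "al y * \<phi> (s y) * (q * (u\<^sup>2 / 4 * d) + \<mu> * (u\<^sup>2 / 4 * e)) =
      u / 4 * (\<phi> (s y) * (q * d + \<mu> * e))" for d e
    using arg_cong[OF au2, of "\<lambda>x. x / 4 * (\<phi> (s y) * (q * d + \<mu> * e))"]
    by (simp add: algebra_simps power2_eq_square)
  \<comment> \<open>\<open>S1\<close>, \<open>S2\<close> and \<open>S4\<close> are the symmetric
    tensors of the claim. A single contraction is not a combination of them, but the sum over the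
    three pairings of the indices is.\<close>
  define S1 where "S1 = hv h y $ i * hv j y $ k + hv h y $ j * hv i y $ k + hv h y $ k * hv i y $ j"
  define S2 where "S2 = hv h y $ k * mv y $ i * mv y $ j + hv h y $ j * mv y $ i * mv y $ k
         + hv h y $ i * mv y $ j * mv y $ k + hv i y $ j * mv y $ h * mv y $ k
         + hv j y $ k * mv y $ i * mv y $ h + hv i y $ k * mv y $ j * mv y $ h"
  define S4 where "S4 = mv y $ h * mv y $ i * mv y $ j * mv y $ k"
  have sum_CW: "Cv i j y \<bullet> Wu h k y + Cv j h y \<bullet> Wu i k y + Cv i h y \<bullet> Wu j k y =
      u\<^sup>2 / 4 * ((r1 (s y))\<^sup>2 * m_sq A B y * S1
        + (4 * (r1 (s y))\<^sup>2 + r1 (s y) * deriv r0 (s y) * m_sq A B y) * S2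
        + (12 * r1 (s y) * deriv r0 (s y) + 3 * (deriv r0 (s y))\<^sup>2 * m_sq A B y) * S4)"
    unfolding cW[OF inner_Cv(3)[OF nz(1)]] sym S1_def S2_def S4_def
    by (simp add: algebra_simps power2_eq_square)
  have sum_mW: "mW i j y * mW h k y + mW j h y * mW i k y + mW i h y * mW j k y =
      u\<^sup>2 / 4 * ((r1 (s y) * m_sq A B y)\<^sup>2 * S1
        + r1 (s y) * m_sq A B y * (2 * r1 (s y) + deriv r0 (s y) * m_sq A B y) * S2
        + 3 * (2 * r1 (s y) + deriv r0 (s y) * m_sq A B y)\<^sup>2 * S4)"
    unfolding mWu sym S1_def S2_def S4_def
    by (simp add: algebra_simps power2_eq_square)
  \<comment> \<open>With \<ell>_i = \<phi> \<alpha>_i + \<phi>' m_i, the \<alpha>_i parts cancel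
    against the derivative of the Cartan tensor, leaving no \<open>av\<close> on the right.\<close>
  have derivs: "F y * pd h (cartan F i j k) y + cartan F h i j y * pd k F y + cartan F h i k y * pd j F y
      + cartan F h j k y * pd i F y + cartan F i j k y * pd h F y =
      u / 2 * (\<phi> (s y) * (- s y * r1 (s y) * S1 - s y * deriv r0 (s y) * S2 + deriv (deriv r0) (s y) * S4)
        + \<phi>1 (s y) * (2 * r1 (s y) * S2 + 4 * deriv r0 (s y) * S4))"
    unfolding pdC[OF pd_cartan[OF y]] has_pd_imp_pd[OF has_pd_F[OF y]] C sym ab_metric_def
      scale1 S1_def S2_def S4_def
    by (simp add: field_simps)
  have contr: "(\<Sum>l\<in>UNIV. cartan F l i j y * cartan_up F l h k y + cartan F l j h y * cartan_up F l i k y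
      + cartan F l i h y * cartan_up F l j k y) =
      q * (Cv i j y \<bullet> Wu h k y + Cv j h y \<bullet> Wu i k y + Cv i h y \<bullet> Wu j k y)
      + \<mu> * (mW i j y * mW h k y + mW j h y * mW i k y + mW i h y * mW j k y)"
    unfolding sum.distrib cc by (simp add: algebra_simps)
  have "T_tensor F h i j k y =
      u / 2 * (\<phi> (s y) * (- s y * r1 (s y) * S1 - s y * deriv r0 (s y) * S2 + deriv (deriv r0) (s y) * S4)
        + \<phi>1 (s y) * (2 * r1 (s y) * S2 + 4 * deriv r0 (s y) * S4))
      - F y * (q * (Cv i j y \<bullet> Wu h k y + Cv j h y \<bullet> Wu i k y + Cv i h y \<bullet> Wu j k y)
      + \<mu> * (mW i j y * mW h k y + mW j h y * mW i k y + mW i h y * mW j k y))"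
    unfolding T_tensor_def contr derivs[symmetric] by simp
  also have "\<dots> = Phi_coeff \<phi> (al y) (s y) (m_sq A B y) * S1 + Psi_coeff \<phi> (al y) (s y) (m_sq A B y) * S2
      + Omega_coeff \<phi> (al y) (s y) (m_sq A B y) * S4"
    unfolding sum_CW sum_mW scale2 ab_metric_def Phi Psi Omega
    by (simp add: field_simps power2_eq_square)
  finally show ?thesis by (simp only: S1_def S2_def S4_def)
qed

end

section \<open>Passage from one tangent space to the manifold\<close>

theorem theorem2p8:
  fixes M :: "'m topology"
    and \<A> :: "('m, 'n::finite) chart set"
    and a :: "('m, 'n) chart \<Rightarrow> 'm \<Rightarrow> real ^ 'n ^ 'n"
    and b :: "('m, 'n) chart \<Rightarrow> 'm \<Rightarrow> real ^ 'n"
    and b0 :: real and J :: "real set" and \<phi> :: "real \<Rightarrow> real"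
  assumes "smooth_manifold M \<A>"
    and "riemannian_metric \<A> a"
    and "one_form \<A> b"
    and "admissible_phi b0 J \<phi>"
    and "\<forall>c\<in>\<A>. \<forall>p\<in>fst c. sqrt (b_sq (a c p) (b c p)) \<le> b0"
    and "\<forall>c\<in>\<A>. \<forall>p\<in>fst c. \<forall>y\<in>ab_domain J (a c p) (b c p). nondegenerate_at \<phi> (a c p) (b c p) y"
  shows "\<forall>c\<in>\<A>. \<forall>p\<in>fst c. \<forall>y\<in>ab_domain J (a c p) (b c p).
    (let F = ab_metric \<phi> (a c p) (b c p);
         al = alpha (a c p) y;
         s = s_var (a c p) (b c p) y;
         m2 = m_sq (a c p) (b c p) y;
         hh = (\<lambda>i j. h_low (a c p) i j y);
         mm = (\<lambda>i. m_low (a c p) (b c p) i y)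
     in
       (\<forall>h i j k. T_tensor F h i j k y =
          Phi_coeff \<phi> al s m2 * (hh h i * hh j k + hh h j * hh i k + hh h k * hh i j)
          + Psi_coeff \<phi> al s m2 *
              (hh h k * mm i * mm j + hh h j * mm i * mm k + hh h i * mm j * mm k
               + hh i j * mm h * mm k + hh j k * mm i * mm h + hh i k * mm j * mm h)
          + Omega_coeff \<phi> al s m2 * (mm h * mm i * mm j * mm k)) \<and>
       K1 \<phi> al s m2 =
         rho1 \<phi> s / (2 * al * (rho \<phi> s + m2 * \<phi> s * deriv (deriv \<phi>) s)) \<and>
       K2 \<phi> al s m2 =
         (rho \<phi> s * deriv (rho0 \<phi>) s - 2 * rho1 \<phi> s * \<phi> s * deriv (deriv \<phi>) s)
           / (2 * al * rho \<phi> s * (rho \<phi> s + m2 * \<phi> s * deriv (deriv \<phi>) s)))"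
proof (intro ballI)
  fix c p y
  assume c: "c \<in> \<A>" and p: "p \<in> fst c" and y: "y \<in> ab_domain J (a c p) (b c p)"
  have "\<phi> t > 0" if "t \<in> J" for t
  proof -
    \<comment> \<open>Positivity of \<phi> at t is assumed only in the presence of some x strictly
      between |t| and \<open>b0\<close>; density of the reals supplies one.\<close>
    have "\<bar>t\<bar> < b0" using assms(4) that by (auto simp: admissible_phi_def)
    then obtain x where "\<bar>t\<bar> < x" "x < b0" using dense by blast
    then show ?thesis using assms(4) that by (auto simp: admissible_phi_def)
  qed
  moreover have "open J" "smooth_on J \<phi>"
    using assms(4) by (auto simp: admissible_phi_def)
  moreover have "transpose (a c p) = a c p" "v \<noteq> 0 \<Longrightarrow> v \<bullet> (a c p *v v) > 0" for v
    using conjunct1[OF assms(2)[unfolded riemannian_metric_def]] c p by simp_all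
  ultimately interpret ab_point "a c p" "b c p" \<phi> J
    by unfold_locales
  have nd: "nondegenerate_at \<phi> (a c p) (b c p) y"
    using assms(6) c p y by blast
  show "let F = ab_metric \<phi> (a c p) (b c p);
         al = alpha (a c p) y;
         s = s_var (a c p) (b c p) y;
         m2 = m_sq (a c p) (b c p) y;
         hh = (\<lambda>i j. h_low (a c p) i j y);
         mm = (\<lambda>i. m_low (a c p) (b c p) i y)
     in
       (\<forall>h i j k. T_tensor F h i j k y =
          Phi_coeff \<phi> al s m2 * (hh h i * hh j k + hh h j * hh i k + hh h k * hh i j)
          + Psi_coeff \<phi> al s m2 *
              (hh h k * mm i * mm j + hh h j * mm i * mm k + hh h i * mm j * mm k
               + hh i j * mm h * mm k + hh j k * mm i * mm h + hh i k * mm j * mm h)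
          + Omega_coeff \<phi> al s m2 * (mm h * mm i * mm j * mm k)) \<and>
       K1 \<phi> al s m2 =
         rho1 \<phi> s / (2 * al * (rho \<phi> s + m2 * \<phi> s * deriv (deriv \<phi>) s)) \<and>
       K2 \<phi> al s m2 =
         (rho \<phi> s * deriv (rho0 \<phi>) s - 2 * rho1 \<phi> s * \<phi> s * deriv (deriv \<phi>) s)
           / (2 * al * rho \<phi> s * (rho \<phi> s + m2 * \<phi> s * deriv (deriv \<phi>) s))"
    unfolding Let_def h_low_eq[OF D_nz[OF y]] m_low_eq[OF D_nz[OF y]]
    by (intro conjI allI T_tensor_eq K_eq y nd)
qed

end
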